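(* Let $n\ge1$ and fix a nonzero homogeneous polynomial $T\in S^4\mathbb{C}^{n+1}$ for which there exists a finite set $A\subset\mathbb{P}^n$ that computes $T$, is minimal for $T$, has cardinality $\ell(A)=2n+1$, and is in linear general position. If there exists a second finite set $B\subset\mathbb{P}^n$, $B\ne A$, that computes $T$ and has $\ell(B)\le 2n+1$, then $\ell(B)=2n+1$ and both $A$ and $B$ are contained in a (common) rational normal curve of $\mathbb{P}^n$.
   Context: $\mathbb{P}^n=\mathbb{P}^n_{\mathbb{C}}$; $S^4\mathbb{C}^{n+1}$ is the space of degree-4 forms in $n+1$ variables over $\mathbb{C}$, and a nonzero $T$ is identified with the point it defines in $\mathbb{P}(S^4\mathbb{C}^{n+1})$. $\nu_4:\mathbb{P}^n\to\mathbb{P}^N$, $N=\binom{n+4}{4}-1$, is the degree-4 Veronese embedding (sending the class of a linear form to the class of its fourth power). $\ell(A)$ is the cardinality of a finite set $A$. A finite set $A\subset\mathbb{P}^n$ computes $T$ if $T\in\langle\nu_4(A)\rangle$, the linear span of $\nu_4(A)$. A set $A$ computing $T$ is minimal for $T$ if there is no proper subset $A'\subsetneq A$ with $T\in\langle\nu_4(A')\rangle$. A finite set $A\subset\mathbb{P}^n$ is in linear general position if every subset of $A$ of cardinality at most $\min\{\ell(A),n+1\}$ is linearly independent. A rational normal curve in $\mathbb{P}^n$ is a curve which, up to a projective linear automorphism of $\mathbb{P}^n$, is the image of the degree-$n$ Veronese embedding of $\mathbb{P}^1$. *)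

theory Defs
  imports "HOL-Analysis.Analysis" "HOL-Library.Poly_Mapping"
begin

text \<open>
  Projective \<open>n\<close>-space over the complex numbers is the set of lines through the origin of
  \<^typ>\<open>complex ^ 'n\<close>, where \<open>CARD('n) = n + 1\<close>; homogeneous coordinates are indexed by
  \<open>'n\<close>. The prefix \<open>vec\<close> refers to complex (not real) linear algebra.
\<close>

definition proj_point :: "complex ^ 'n \<Rightarrow> (complex ^ 'n) set" where
  "proj_point v = vec.span {v}"

definition proj_space :: "(complex ^ 'n) set set" where
  "proj_space = {proj_point v | v. v \<noteq> 0}"


text \<open>
  Complex polynomials in variables indexed by \<open>'n\<close>: finitely supported maps from exponent
  vectors to coefficients, with convolution as multiplication.
\<close>

type_synonym 'n polynomial = "('n \<Rightarrow>\<^sub>0 nat) \<Rightarrow>\<^sub>0 complex"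

definition poly_scale :: "complex \<Rightarrow> 'n polynomial \<Rightarrow> 'n polynomial" where
  "poly_scale c p = Poly_Mapping.single 0 c * p"

interpretation mpoly: vector_space poly_scale
  by unfold_locales
    (simp_all add: poly_scale_def algebra_simps single_add flip: mult_single[of 0 _ 0, simplified])

definition forms :: "nat \<Rightarrow> ('n::finite) polynomial set" where
  "forms d = {p. \<forall>m \<in> Poly_Mapping.keys p. (\<Sum>i\<in>UNIV. Poly_Mapping.lookup m i) = d}"

definition linear_form :: "complex ^ 'n \<Rightarrow> 'n polynomial" where
  "linear_form v = (\<Sum>i\<in>UNIV. Poly_Mapping.single (Poly_Mapping.single i 1) (v $ i))"

text \<open>
  The Veronese embedding sends the class of a linear form to the class of its \<open>d\<close>-th power.
  The vectors of a point \<open>P\<close> are proportional, hence so are the \<open>d\<close>-th powers of the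
  corresponding linear forms, and the span below is a line in the space of forms of degree \<open>d\<close>.
\<close>

definition veronese :: "nat \<Rightarrow> (complex ^ 'n) set \<Rightarrow> 'n polynomial set" where
  "veronese d P = mpoly.span ((\<lambda>v. linear_form v ^ d) ` P)"

text \<open>A nonzero quartic form stands for the point of projective space that it defines.\<close>

definition computes :: "(complex ^ 'n) set set \<Rightarrow> 'n polynomial \<Rightarrow> bool" where
  "computes A T \<longleftrightarrow> finite A \<and> A \<subseteq> proj_space \<and> T \<in> mpoly.span (\<Union>P\<in>A. veronese 4 P)"

definition minimal_for :: "(complex ^ 'n) set set \<Rightarrow> 'n polynomial \<Rightarrow> bool" where
  "minimal_for A T \<longleftrightarrow> computes A T \<and>
     (\<forall>A'. A' \<subset> A \<longrightarrow> T \<notin> mpoly.span (\<Union>P\<in>A'. veronese 4 P))"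

text \<open>
  Distinct points have distinct nonzero representatives, so no multiplicities are lost in
  passing to the set of representatives.
\<close>

definition lin_indep_points :: "(complex ^ 'n) set set \<Rightarrow> bool" where
  "lin_indep_points S \<longleftrightarrow>
     (\<forall>r. (\<forall>P\<in>S. r P \<in> P \<and> r P \<noteq> 0) \<longrightarrow> vec.independent (r ` S))"

definition linear_general_position :: "(complex ^ 'n) set set \<Rightarrow> bool" where
  "linear_general_position A \<longleftrightarrow>
     (\<forall>S \<subseteq> A. card S \<le> min (card A) CARD('n) \<longrightarrow> lin_indep_points S)"

text \<open>
  The image of the projective line under the map
  \<open>[s : t] \<mapsto> [s ^ n : s ^ (n - 1) * t : \<dots> : t ^ n]\<close>, with \<open>n = CARD('n) - 1\<close>. As the
  index type carries no order, \<open>e\<close> numbers the coordinates by \<open>0, \<dots>, n\<close>; another numbering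
  changes the curve by a permutation of the coordinates.
\<close>

definition standard_rational_normal_curve :: "('n::finite \<Rightarrow> nat) \<Rightarrow> (complex ^ 'n) set set" where
  "standard_rational_normal_curve e =
     {proj_point (\<chi> i. s ^ (CARD('n) - 1 - e i) * t ^ e i) | s t. (s, t) \<noteq> (0, 0)}"

definition rational_normal_curve :: "(complex ^ 'n) set set \<Rightarrow> bool" where
  "rational_normal_curve C \<longleftrightarrow>
     (\<exists>(g :: complex ^ 'n ^ 'n) e. invertible g \<and> bij_betw e UNIV {..<CARD('n)} \<and>
        C = (\<lambda>P. (*v) g ` P) ` standard_rational_normal_curve e)"

end

theory Submission
  imports Defs
begin

text \<open>
  Write \<open>T = \<Sum>\<^sub>a \<alpha>\<^sub>a a\<^sup>4 = \<Sum>\<^sub>b \<beta>\<^sub>b b\<^sup>4\<close>, so that \<open>\<Sum>\<^sub>a \<alpha>\<^sub>a F(a) = \<Sum>\<^sub>b \<beta>\<^sub>b F(b)\<close> for every product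
  \<open>F\<close> of four linear functionals. Splitting \<open>A - {a}\<close> into two sets of \<open>n\<close> points, each spanning a
  hyperplane, gives a quadric \<open>E\<^sub>a\<close> that vanishes on \<open>A\<close> except at \<open>a\<close>. Taking \<open>F = E\<^sub>a E\<^sub>a'\<close> shows
  that \<open>B\<close> has at least \<open>2n + 1\<close> points, and then that every quadric through \<open>A\<close> contains \<open>B\<close>. Varying
  the splittings, no point of \<open>B - A\<close> lies on a hyperplane spanned by points of \<open>A\<close>.

  Now take \<open>n + 1\<close> points of \<open>A\<close> as coordinate points, let \<open>P\<close> be the set of the other \<open>n\<close>, and let
  \<open>u\<close> be the functional vanishing on \<open>P\<close>. For \<open>b \<in> B - A\<close>, interpolating the quadrics \<open>x\<^sub>i x\<^sub>j\<close> on \<open>A\<close>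
  expresses \<open>b b\<^sup>T\<close> as a diagonal matrix plus a combination of the \<open>p p\<^sup>T\<close> for \<open>p \<in> P\<close>, whence
  \<open>\<Sum>\<^sub>i u\<^sub>i p\<^sub>i q\<^sub>i / b\<^sub>i = 0\<close> for distinct \<open>p, q \<in> P\<close>. So for \<open>b, b' \<in> B - A\<close> the three vectors
  \<open>u\<close>, \<open>(u\<^sub>i p\<^sub>i / b\<^sub>i)\<close> and \<open>(u\<^sub>i p\<^sub>i / b'\<^sub>i)\<close> lie in the plane orthogonal to \<open>P - {p}\<close>, and
  coordinatewise \<open>1/p\<close> is a combination of \<open>1/b\<close> and \<open>1/b'\<close>. Hence the Cremona transformation
  \<open>v \<mapsto> 1/v\<close> maps \<open>P\<close> and \<open>B - A\<close> into a line, and its inverse maps this line to a rational normal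
  curve through the coordinate points.
\<close>

section \<open>Linear algebra\<close>

text \<open>Gaussian elimination, one equation at a time: a pivot \<open>a0\<close> for the equation
  \<open>b0\<close> is eliminated from the others.\<close>

lemma underdetermined_system:
  fixes X :: "'a \<Rightarrow> 'b \<Rightarrow> 'k::field"
  assumes "finite B" "finite A" "card B < card A"
  shows "\<exists>c. (\<exists>a\<in>A. c a \<noteq> 0) \<and> (\<forall>b\<in>B. (\<Sum>a\<in>A. c a * X a b) = 0)"
  using assms
proof (induction B arbitrary: A X rule: finite_induct)
  case empty
  then have "A \<noteq> {}" by auto
  then show ?case by (intro exI[of _ "\<lambda>_. 1"]) auto
next
  case (insert b0 B)
  show ?case
  proof (cases "\<forall>a\<in>A. X a b0 = 0")
    case True
    have "card B < card A" using insert.prems insert.hyps by simp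
    from insert.IH[OF insert.prems(1) this, of X] show ?thesis using True by auto
  next
    case False
    then obtain a0 where a0: "a0 \<in> A" "X a0 b0 \<noteq> 0" by blast
    have "finite (A - {a0})" "card B < card (A - {a0})"
      using insert.prems insert.hyps a0 by auto
    from insert.IH[OF this, of "\<lambda>a b. X a b - X a b0 / X a0 b0 * X a0 b"]
    obtain c where c: "\<exists>a\<in>A - {a0}. c a \<noteq> 0"
      and c0: "\<And>b. b \<in> B \<Longrightarrow> (\<Sum>a\<in>A - {a0}. c a * (X a b - X a b0 / X a0 b0 * X a0 b)) = 0"
      by blast
    \<comment> \<open>The value of the pivot unknown that is forced by the equation
      \<open>b0\<close>.\<close>
    define d where "d = - (\<Sum>a\<in>A - {a0}. c a * (X a b0 / X a0 b0))"
    have split: "(\<Sum>a\<in>A. (c(a0 := d)) a * X a b) = d * X a0 b + (\<Sum>a\<in>A - {a0}. c a * X a b)" for b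
      using a0 insert.prems by (simp add: sum.remove[of A a0])
    have "(\<Sum>a\<in>A. (c(a0 := d)) a * X a b0) = 0"
      unfolding split using a0 by (simp add: d_def sum_distrib_right sum_negf)
    moreover have "(\<Sum>a\<in>A. (c(a0 := d)) a * X a b) = 0" if "b \<in> B" for b
      unfolding split using c0[OF that]
      by (simp add: d_def sum_distrib_right sum_distrib_left sum_subtractf algebra_simps)
    moreover have "\<exists>a\<in>A. (c(a0 := d)) a \<noteq> 0" using c by auto
    ultimately show ?thesis by (intro exI[of _ "c(a0 := d)"]) auto
  qed
qed

text \<open>A linear relation \<open>c\<close> between the rows of \<open>X\<close> is killed by
  multiplying with the right inverse \<open>Y\<close>, so the rows are independent.\<close>

lemma right_inverse_imp_card_le:
  fixes X Y :: "'a \<Rightarrow> 'b \<Rightarrow> 'k::field"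
  assumes "finite A" "finite B"
    and inv: "\<And>a a'. a \<in> A \<Longrightarrow> a' \<in> A \<Longrightarrow> (\<Sum>b\<in>B. X a b * Y a' b) = (if a = a' then 1 else 0)"
  shows "card A \<le> card B"
proof (rule ccontr)
  assume "\<not> card A \<le> card B"
  then obtain c a' where a': "a' \<in> A" "c a' \<noteq> 0"
    and c: "\<And>b. b \<in> B \<Longrightarrow> (\<Sum>a\<in>A. c a * X a b) = 0"
    using underdetermined_system[of B A X] assms(1,2) by (metis not_le)
  have "0 = (\<Sum>b\<in>B. (\<Sum>a\<in>A. c a * X a b) * Y a' b)" using c by simp
  also have "\<dots> = (\<Sum>b\<in>B. \<Sum>a\<in>A. c a * (X a b * Y a' b))"
    by (simp add: sum_distrib_right mult.assoc)
  also have "\<dots> = (\<Sum>a\<in>A. c a * (\<Sum>b\<in>B. X a b * Y a' b))"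
    by (subst sum.swap) (simp add: sum_distrib_left)
  also have "\<dots> = (\<Sum>a\<in>A. if a = a' then c a else 0)"
    using a' inv by (intro sum.cong) auto
  also have "\<dots> = c a'" using a' assms(1) by simp
  finally show False using a' by simp
qed

lemma right_inverse_imp_trivial_kernel:
  fixes X Y :: "'a \<Rightarrow> 'b \<Rightarrow> 'k::field"
  assumes "finite A" "finite B" and card: "card B \<le> card A"
    and inv: "\<And>a a'. a \<in> A \<Longrightarrow> a' \<in> A \<Longrightarrow> (\<Sum>b\<in>B. X a b * Y a' b) = (if a = a' then 1 else 0)"
    and ker: "\<And>a. a \<in> A \<Longrightarrow> (\<Sum>b\<in>B. X a b * f b) = 0"
    and b0: "b0 \<in> B"
  shows "f b0 = 0"
proof (rule ccontr)
  assume f: "f b0 \<noteq> 0"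
  define Z where "Z a b = Y a b - Y a b0 / f b0 * f b" for a b
  have "(\<Sum>b\<in>B - {b0}. X a b * Z a' b) = (if a = a' then 1 else 0)" if "a \<in> A" "a' \<in> A" for a a'
  proof -
    have "(\<Sum>b\<in>B. X a b * Z a' b)
        = (\<Sum>b\<in>B. X a b * Y a' b) - Y a' b0 / f b0 * (\<Sum>b\<in>B. X a b * f b)"
      by (simp add: Z_def sum_subtractf algebra_simps sum_distrib_left)
    moreover have "Z a' b0 = 0" using f by (simp add: Z_def)
    ultimately show ?thesis
      using inv[OF that] ker[OF that(1)] b0 assms(2) by (simp add: sum.remove[of B b0])
  qed
  then have "card A \<le> card (B - {b0})"
    using assms(1,2) by (intro right_inverse_imp_card_le[of A "B - {b0}" X Z]) auto
  then show False using card b0 assms(2) by (metis card_Diff1_less not_less order_trans)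
qed

section \<open>Linear functionals as vectors, through the bilinear pairing without
  conjugation\<close>

definition cdot :: "'k::field ^ 'n \<Rightarrow> 'k ^ 'n \<Rightarrow> 'k" where
  "cdot l v = (\<Sum>i\<in>UNIV. l $ i * v $ i)"

lemma cdot_add_left: "cdot (l + m) v = cdot l v + cdot m v"
  and cdot_add_right: "cdot l (v + w) = cdot l v + cdot l w"
  and cdot_scale_left: "cdot (c *s l) v = c * cdot l v"
  and cdot_scale_right: "cdot l (c *s v) = c * cdot l v"
  by (simp_all add: cdot_def algebra_simps sum.distrib sum_distrib_left)

lemma cdot_zero [simp]: "cdot l 0 = 0" "cdot 0 v = 0"
  by (simp_all add: cdot_def)

lemma cdot_sum_right: "cdot l (\<Sum>x\<in>S. f x) = (\<Sum>x\<in>S. cdot l (f x))"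
  by (induction S rule: infinite_finite_induct) (simp_all add: cdot_add_right)

lemma cdot_combination_single:
  assumes "finite T" "t \<in> T" "\<And>s. s \<in> T - {t} \<Longrightarrow> cdot l s = 0"
  shows "cdot l (\<Sum>s\<in>T. y s *s s) = y t * cdot l t"
proof -
  have "(\<Sum>s\<in>T - {t}. y s * cdot l s) = 0" using assms(3) by (simp add: sum.neutral)
  then show ?thesis using assms(1,2)
    by (simp add: sum.remove[of T t] cdot_add_right cdot_sum_right cdot_scale_right)
qed

lemma cdot_axis_right [simp]: "cdot l (axis i 1) = l $ i"
  by (simp add: cdot_def axis_def if_distrib cong: if_cong)

lemma cdot_eq_0_imp_zero: "(\<And>v. cdot l v = 0) \<Longrightarrow> l = 0"
  by (metis cdot_axis_right vec_eq_iff zero_index)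

lemma annihilating_functional_exists:
  fixes S :: "('k::field ^ 'n) set"
  assumes "finite S" "card S < CARD('n)"
  obtains l where "l \<noteq> 0" "\<And>s. s \<in> S \<Longrightarrow> cdot l s = 0"
proof -
  obtain c where c: "\<exists>i. c i \<noteq> 0" "\<And>s. s \<in> S \<Longrightarrow> (\<Sum>i\<in>UNIV. c i * s $ i) = 0"
    using underdetermined_system[of S "UNIV :: 'n set" "\<lambda>i s. s $ i"] assms by auto
  show thesis
    by (rule that[of "\<chi> i. c i"]) (use c in \<open>auto simp: vec_eq_iff cdot_def\<close>)
qed

section \<open>Powers of linear forms\<close>

lemma span_finite_family:
  assumes "finite A" "x \<in> mpoly.span (f ` A)"
  obtains c where "x = (\<Sum>a\<in>A. poly_scale (c a) (f a))"
proof -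
  let ?W = "{\<Sum>a\<in>A. poly_scale (c a) (f a) | c. True}"
  have "mpoly.subspace ?W"
  proof (rule mpoly.subspaceI)
    show "0 \<in> ?W" by (auto intro!: exI[of _ "\<lambda>_. 0"])
  next
    fix x y assume "x \<in> ?W" "y \<in> ?W"
    then obtain c d where "x = (\<Sum>a\<in>A. poly_scale (c a) (f a))" "y = (\<Sum>a\<in>A. poly_scale (d a) (f a))"
      by auto
    then show "x + y \<in> ?W"
      by (auto intro!: exI[of _ "\<lambda>a. c a + d a"] simp: mpoly.scale_left_distrib sum.distrib)
  next
    fix k x assume "x \<in> ?W"
    then obtain c where "x = (\<Sum>a\<in>A. poly_scale (c a) (f a))" by auto
    then show "poly_scale k x \<in> ?W"
      by (auto intro!: exI[of _ "\<lambda>a. k * c a"] simp: mpoly.scale_sum_right)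
  qed
  moreover have "f ` A \<subseteq> ?W"
  proof safe
    fix a assume "a \<in> A"
    then show "\<exists>c. f a = (\<Sum>a\<in>A. poly_scale (c a) (f a)) \<and> True"
      using assms(1)
      by (intro exI[of _ "\<lambda>x. if x = a then 1 else 0"])
         (simp add: if_distrib[of "\<lambda>c. poly_scale c _"] cong: if_cong)
  qed
  ultimately have "mpoly.span (f ` A) \<subseteq> ?W" by (rule mpoly.span_minimal[rotated])
  with assms(2) that show thesis by auto
qed

lemma lookup_poly_scale: "Poly_Mapping.lookup (poly_scale c p) m = c * Poly_Mapping.lookup p m"
proof -
  have "poly_scale c p = Poly_Mapping.map ((*) c) p"
    by (simp add: poly_scale_def mult_map_scale_conv_mult)
  then show ?thesis by (simp add: map.rep_eq when_def)
qed

lemma linear_form_scale: "linear_form (c *s v) = poly_scale c (linear_form v)"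
  by (simp add: linear_form_def poly_scale_def sum_distrib_left mult_single)

lemma proj_point_scale:
  assumes "k \<noteq> 0"
  shows "proj_point (k *s v) = proj_point v"
proof -
  have "v \<in> vec.span {k *s v}"
    using vec.span_scale[OF vec.span_base[of "k *s v" "{k *s v}"], of "1 / k"] assms by simp
  moreover have "k *s v \<in> vec.span {v}" by (simp add: vec.span_base vec.span_scale)
  ultimately show ?thesis unfolding proj_point_def
    by (meson vec.span_minimal vec.subspace_span empty_subsetI insert_subset subset_antisym)
qed

lemma matrix_image_proj_point: "(*v) g ` proj_point v = proj_point (g *v v)"
  by (simp add: proj_point_def vec.linear_span_image[OF matrix_vector_mul_linear_gen, symmetric])

lemma veronese_proj_point: "veronese d (proj_point v) = mpoly.span {linear_form v ^ d}"
proof -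
  have "linear_form (c *s v) ^ d = poly_scale (c ^ d) (linear_form v ^ d)" for c
  proof (induction d)
    case (Suc d)
    then show ?case
      by (simp add: linear_form_scale poly_scale_def algebra_simps flip: mult_single[of 0 c 0 "c^d", simplified])
  qed (simp add: poly_scale_def)
  then have "(\<lambda>w. linear_form w ^ d) ` proj_point v \<subseteq> mpoly.span {linear_form v ^ d}"
    by (auto simp: proj_point_def vec.span_singleton mpoly.span_base mpoly.span_scale)
  moreover have "linear_form v ^ d \<in> (\<lambda>w. linear_form w ^ d) ` proj_point v"
    by (auto simp: proj_point_def vec.span_base)
  ultimately show ?thesis unfolding veronese_def
    by (meson mpoly.span_minimal mpoly.span_mono mpoly.subspace_span empty_subsetI insert_subset subset_antisym)
qed

section \<open>Coefficients of fourth powers and moments\<close>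

definition monomial_value :: "complex ^ 'n \<Rightarrow> ('n::finite \<Rightarrow>\<^sub>0 nat) \<Rightarrow> complex" where
  "monomial_value v m = (\<Prod>i\<in>UNIV. v $ i ^ Poly_Mapping.lookup m i)"

lemma monomial_value_add: "monomial_value v (m + m') = monomial_value v m * monomial_value v m'"
  by (simp add: monomial_value_def lookup_add power_add prod.distrib)

lemma monomial_value_single: "monomial_value v (Poly_Mapping.single i (Suc 0)) = v $ i"
proof -
  have "monomial_value v (Poly_Mapping.single i (Suc 0)) = (\<Prod>j\<in>UNIV. if j = i then v $ j else 1)"
    unfolding monomial_value_def by (intro prod.cong) (auto simp: lookup_single when_def)
  then show ?thesis by simp
qed

abbreviation quartic_exponent :: "'n \<times> 'n \<times> 'n \<times> 'n \<Rightarrow> 'n \<Rightarrow>\<^sub>0 nat" where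
  "quartic_exponent x \<equiv> (case x of (i, j, k, l) \<Rightarrow> Poly_Mapping.single i 1 +
     Poly_Mapping.single j 1 + Poly_Mapping.single k 1 + Poly_Mapping.single l 1)"

text \<open>The fourth power expands over ordered quadruples of variables. All quadruples with
  exponent \<open>m\<close> contribute the same value, and their number is the multinomial
  coefficient.\<close>

lemma lookup_linear_form_power_4:
  fixes v :: "complex ^ ('n::finite)"
  shows "Poly_Mapping.lookup (linear_form v ^ 4) m =
    monomial_value v m * of_nat (card {x. quartic_exponent x = m})"
proof -
  let ?e = "\<lambda>i::'n. Poly_Mapping.single i (1::nat)"
  have "linear_form v ^ 4 = linear_form v * (linear_form v * (linear_form v * linear_form v))"
    by (simp add: eval_nat_numeral mult.assoc)
  also have "\<dots> = (\<Sum>i\<in>UNIV. \<Sum>j\<in>UNIV. \<Sum>k\<in>UNIV. \<Sum>l\<in>UNIV.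
      Poly_Mapping.single (?e i + ?e j + ?e k + ?e l) (v $ i * v $ j * v $ k * v $ l))"
    unfolding linear_form_def sum_product sum_distrib_left sum_distrib_right mult_single
    by (simp add: add_ac mult_ac)
  also have "\<dots> = (\<Sum>x\<in>UNIV. Poly_Mapping.single (quartic_exponent x) (monomial_value v (quartic_exponent x)))"
    by (simp add: sum.cartesian_product monomial_value_add monomial_value_single case_prod_beta
        flip: UNIV_Times_UNIV)
  finally have "Poly_Mapping.lookup (linear_form v ^ 4) m =
      (\<Sum>x\<in>UNIV. if quartic_exponent x = m then monomial_value v m else 0)"
    by (auto simp: lookup_sum lookup_single when_def intro!: sum.cong)
  also have "\<dots> = monomial_value v m * of_nat (card {x. quartic_exponent x = m})"
    by (simp add: sum.If_cases)
  finally show ?thesis .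
qed

text \<open>The coefficient of a monomial in \<open>v\<^sup>4\<close> is its value at \<open>v\<close> times a multinomial coefficient,
  which is nonzero and does not depend on \<open>v\<close>.\<close>

lemma quartic_moments_eq:
  fixes A B :: "(complex ^ ('n::finite)) set"
  assumes eq: "(\<Sum>v\<in>A. poly_scale (\<alpha> v) (linear_form v ^ 4)) =
    (\<Sum>v\<in>B. poly_scale (\<beta> v) (linear_form v ^ 4))"
  shows "(\<Sum>v\<in>A. \<alpha> v * (cdot p v * cdot q v * cdot r v * cdot s v)) =
    (\<Sum>v\<in>B. \<beta> v * (cdot p v * cdot q v * cdot r v * cdot s v))"
proof -
  have mon: "(\<Sum>v\<in>A. \<alpha> v * (v $ i * v $ j * v $ k * v $ l)) =
      (\<Sum>v\<in>B. \<beta> v * (v $ i * v $ j * v $ k * v $ l))" for i j k l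
  proof -
    let ?m = "quartic_exponent (i, j, k, l)"
    define N where "N = card {x :: 'n \<times> 'n \<times> 'n \<times> 'n. quartic_exponent x = ?m}"
    have "(i, j, k, l) \<in> {x. quartic_exponent x = ?m}" by simp
    then have "N \<noteq> 0" unfolding N_def by (metis card_0_eq empty_iff finite)
    have val: "monomial_value v ?m = v $ i * v $ j * v $ k * v $ l" for v
      by (simp add: monomial_value_add monomial_value_single)
    have lookup: "Poly_Mapping.lookup (\<Sum>v\<in>S. poly_scale (\<gamma> v) (linear_form v ^ 4)) ?m =
        (\<Sum>v\<in>S. \<gamma> v * (v $ i * v $ j * v $ k * v $ l)) * of_nat N"
      for S :: "(complex ^ 'n) set" and \<gamma>
      unfolding lookup_sum lookup_poly_scale lookup_linear_form_power_4 val N_def[symmetric]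
      by (simp add: sum_distrib_right mult.assoc)
    have "(\<Sum>v\<in>A. \<alpha> v * (v $ i * v $ j * v $ k * v $ l)) * of_nat N =
        (\<Sum>v\<in>B. \<beta> v * (v $ i * v $ j * v $ k * v $ l)) * of_nat N"
      unfolding lookup[symmetric] eq ..
    with \<open>N \<noteq> 0\<close> show ?thesis by simp
  qed
  have expand: "(\<Sum>v\<in>S. \<gamma> v * (cdot p v * cdot q v * cdot r v * cdot s v)) =
      (\<Sum>i\<in>UNIV. \<Sum>j\<in>UNIV. \<Sum>k\<in>UNIV. \<Sum>l\<in>UNIV. s $ i * r $ j * q $ k * p $ l *
        (\<Sum>v\<in>S. \<gamma> v * (v $ i * v $ j * v $ k * v $ l)))" for S and \<gamma> :: "_ \<Rightarrow> complex"
  proof -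
    have "\<gamma> v * (cdot p v * cdot q v * cdot r v * cdot s v) =
      (\<Sum>i\<in>UNIV. \<Sum>j\<in>UNIV. \<Sum>k\<in>UNIV. \<Sum>l\<in>UNIV. s $ i * r $ j * q $ k * p $ l *
        (\<gamma> v * (v $ i * v $ j * v $ k * v $ l)))" for v
    proof -
      have "\<gamma> v * (cdot p v * cdot q v * cdot r v * cdot s v) =
          \<gamma> v * (cdot p v * (cdot q v * (cdot r v * cdot s v)))" by (simp add: mult.assoc)
      then show ?thesis unfolding cdot_def sum_product sum_distrib_left sum_distrib_right
        by (simp add: mult_ac)
    qed
    then show ?thesis
      unfolding sum_distrib_left by (simp only: sum.swap[of _ _ S])
  qed
  show ?thesis unfolding expand mon ..
qed

section \<open>Products of binary linear forms\<close>

lemma homogeneous_product_coefficients: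
  fixes \<phi> \<psi> :: "'a \<Rightarrow> 'k::field"
  assumes "finite J"
  shows "\<exists>c. \<forall>s t. (\<Prod>j\<in>J. s * \<phi> j + t * \<psi> j) = (\<Sum>k\<le>card J. c k * (s ^ (card J - k) * t ^ k))"
  using assms
proof (induction J rule: finite_induct)
  case empty
  then show ?case by (auto intro!: exI[of _ "\<lambda>_. 1"])
next
  case (insert i J)
  let ?d = "card J"
  obtain c where c: "\<And>s t. (\<Prod>j\<in>J. s * \<phi> j + t * \<psi> j) = (\<Sum>k\<le>?d. c k * (s ^ (?d - k) * t ^ k))"
    using insert.IH by blast
  \<comment> \<open>The first summand comes from the factor \<open>s\<close>, the second, shifted by
    one, from \<open>t\<close>. The case distinctions discard \<open>c\<close> beyond degree
    \<open>?d\<close> and the index \<open>k - 1\<close> at \<open>k = 0\<close>.\<close>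
  define e where "e k = (if k \<le> ?d then c k * \<phi> i else 0) + (if k = 0 then 0 else c (k - 1) * \<psi> i)" for k
  have "(\<Prod>j\<in>insert i J. s * \<phi> j + t * \<psi> j) = (\<Sum>k\<le>Suc ?d. e k * (s ^ (Suc ?d - k) * t ^ k))" for s t
  proof -
    have "(\<Sum>k\<le>Suc ?d. e k * (s ^ (Suc ?d - k) * t ^ k)) =
        (\<Sum>k\<le>Suc ?d. (if k \<le> ?d then c k * \<phi> i else 0) * (s ^ (Suc ?d - k) * t ^ k)) +
        (\<Sum>k\<le>Suc ?d. (if k = 0 then 0 else c (k - 1) * \<psi> i) * (s ^ (Suc ?d - k) * t ^ k))"
      by (simp add: e_def distrib_right sum.distrib)
    also have "(\<Sum>k\<le>Suc ?d. (if k \<le> ?d then c k * \<phi> i else 0) * (s ^ (Suc ?d - k) * t ^ k)) =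
        s * \<phi> i * (\<Sum>k\<le>?d. c k * (s ^ (?d - k) * t ^ k))"
      by (simp add: sum_distrib_left Suc_diff_le mult_ac)
    also have "(\<Sum>k\<le>Suc ?d. (if k = 0 then 0 else c (k - 1) * \<psi> i) * (s ^ (Suc ?d - k) * t ^ k)) =
        t * \<psi> i * (\<Sum>k\<le>?d. c k * (s ^ (?d - k) * t ^ k))"
      by (subst sum.atMost_Suc_shift) (simp add: sum_distrib_left mult_ac)
    finally show ?thesis using insert.hyps by (simp add: c distrib_right)
  qed
  then show ?case using insert.hyps by (auto intro!: exI[of _ e])
qed

lemma invertible_if_multiples_of_axes_in_range:
  fixes g :: "'k::field ^ 'n ^ 'n"
  assumes "\<And>i. \<exists>c w. c \<noteq> 0 \<and> g *v w = c *s axis i 1"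
  shows "invertible g"
proof -
  obtain c w where cw: "\<And>i. c i \<noteq> 0" "\<And>i. g *v w i = c i *s axis i 1"
    using assms by metis
  have "\<exists>v. g *v v = y" for y
  proof -
    have "g *v (\<Sum>i\<in>UNIV. (y $ i / c i) *s w i) = (\<Sum>i\<in>UNIV. (y $ i / c i) *s (c i *s axis i 1))"
      by (simp add: vec.linear_sum[OF matrix_vector_mul_linear_gen]
          vec.linear_scale[OF matrix_vector_mul_linear_gen] cw(2) del: vector_smult_assoc)
    also have "\<dots> = (\<Sum>i\<in>UNIV. y $ i *s axis i 1)" using cw(1) by (simp add: vector_smult_assoc)
    also have "\<dots> = y" by (simp add: basis_expansion)
    finally show ?thesis by blast
  qed
  then have "surj ((*v) g)" by (metis surjI)
  then show ?thesis by (simp add: invertible_right_inverse matrix_right_invertible_surjective)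
qed

text \<open>The factors \<open>s \<phi> i + t \<psi> i\<close> are pairwise non-proportional linear forms, so the products
  omitting one of them form a basis of the binary forms of degree \<open>CARD('n) - 1\<close>.\<close>

lemma products_omitting_one_factor:
  fixes \<phi> \<psi> :: "'n::finite \<Rightarrow> 'k::field"
  assumes indep: "\<And>i j. i \<noteq> j \<Longrightarrow> \<phi> i * \<psi> j \<noteq> \<phi> j * \<psi> i"
    and e: "bij_betw e (UNIV :: 'n set) {..<CARD('n)}"
  shows "\<exists>g :: 'k ^ 'n ^ 'n. invertible g \<and> (\<forall>s t.
    g *v (\<chi> i. s ^ (CARD('n) - 1 - e i) * t ^ e i) = (\<chi> i. \<Prod>j\<in>UNIV - {i}. s * \<phi> j + t * \<psi> j))"
proof -
  let ?d = "CARD('n) - 1"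
  have "\<forall>i. \<exists>c. \<forall>s t. (\<Prod>j\<in>UNIV - {i}. s * \<phi> j + t * \<psi> j) = (\<Sum>k\<le>?d. c k * (s ^ (?d - k) * t ^ k))"
    using homogeneous_product_coefficients[of "UNIV - {_}" \<phi> \<psi>] by simp
  from choice[OF this] obtain c where
    c: "\<And>i s t. (\<Prod>j\<in>UNIV - {i}. s * \<phi> j + t * \<psi> j) = (\<Sum>k\<le>?d. c i k * (s ^ (?d - k) * t ^ k))"
    by blast
  define g :: "'k ^ 'n ^ 'n" where "g = (\<chi> i j. c i (e j))"
  have "CARD('n) = Suc ?d" by simp
  then have "{..<CARD('n)} = {..?d}" by (metis lessThan_Suc_atMost)
  with e have e': "bij_betw e UNIV {..?d}" by simp
  have g: "g *v (\<chi> i. s ^ (?d - e i) * t ^ e i) = (\<chi> i. \<Prod>j\<in>UNIV - {i}. s * \<phi> j + t * \<psi> j)" for s t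
  proof -
    have "(\<Sum>j\<in>UNIV. c i (e j) * (s ^ (?d - e j) * t ^ e j)) = (\<Sum>k\<le>?d. c i k * (s ^ (?d - k) * t ^ k))" for i
      by (rule sum.reindex_bij_betw[OF e'])
    then show ?thesis unfolding c g_def by (simp add: vec_eq_iff matrix_vector_mult_def)
  qed
  have "invertible g"
  proof (rule invertible_if_multiples_of_axes_in_range)
    fix i
    \<comment> \<open>The parameter \<open>(\<psi> i, - \<phi> i)\<close> is the zero of the factor
      \<open>i\<close>; only the product omitting that factor survives there.\<close>
    define k where "k = (\<Prod>j\<in>UNIV - {i}. \<psi> i * \<phi> j + - \<phi> i * \<psi> j)"
    have "(\<Prod>j\<in>UNIV - {i'}. \<psi> i * \<phi> j + - \<phi> i * \<psi> j) = 0" if "i' \<noteq> i" for i'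
      using that by (intro prod_zero) (auto intro!: bexI[of _ i])
    then have "(\<chi> i'. \<Prod>j\<in>UNIV - {i'}. \<psi> i * \<phi> j + - \<phi> i * \<psi> j) = k *s axis i 1"
      by (auto simp: vec_eq_iff axis_def k_def)
    then have "g *v (\<chi> i'. \<psi> i ^ (?d - e i') * (- \<phi> i) ^ e i') = k *s axis i 1"
      unfolding g .
    moreover have "k \<noteq> 0" unfolding k_def using indep[of _ i] by (auto simp: mult.commute)
    ultimately show "\<exists>c w. c \<noteq> 0 \<and> g *v w = c *s axis i 1" by blast
  qed
  with g show ?thesis by blast
qed

section \<open>Points in linear general position\<close>

locale points_in_general_position =
  fixes A :: "(complex ^ 'n) set" and n :: nat
  assumes CARD_eq: "CARD('n) = Suc n"
    and card_A: "card A = 2 * n + 1"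
    and independent: "\<And>S. S \<subseteq> A \<Longrightarrow> card S \<le> Suc n \<Longrightarrow> vec.independent S"
begin

lemma finite_A: "finite A"
  using card_A by (metis Suc_eq_plus1 card.infinite nat.distinct(1))

lemma expansion:
  assumes "S \<subseteq> A" "card S = Suc n"
  obtains x where "v = (\<Sum>s\<in>S. x s *s s)"
proof -
  have fin: "finite S" using assms(1) finite_A finite_subset by blast
  have "vec.dim S = vec.dimension TYPE(complex) TYPE('n)"
    using vec.dim_eq_card_independent[OF independent[of S]] assms CARD_eq
    by (simp add: vec.dimension_def card_cart_basis)
  then have "vec.span S = UNIV" by (simp add: vec.dim_eq_full)
  then have "v \<in> vec.span S" by simp
  then show thesis using that vec.span_finite[OF fin] by auto
qed

text \<open>Otherwise \<open>l\<close> would vanish on the \<open>n + 1\<close> points of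
  \<open>insert a S\<close>, which form a basis.\<close>

lemma functional_nonzero:
  assumes "S \<subseteq> A" "card S = n" "\<And>s. s \<in> S \<Longrightarrow> cdot l s = 0" "l \<noteq> 0" "a \<in> A - S"
  shows "cdot l a \<noteq> 0"
proof
  assume "cdot l a = 0"
  have fin: "finite S" using assms(1) finite_A finite_subset by blast
  have "cdot l v = 0" for v
  proof -
    obtain x where "v = (\<Sum>s\<in>insert a S. x s *s s)"
      using expansion[of "insert a S" v] assms fin by auto
    then show ?thesis
      using assms(3) \<open>cdot l a = 0\<close> by (auto simp: cdot_sum_right cdot_scale_right intro!: sum.neutral)
  qed
  then show False using assms(4) cdot_eq_0_imp_zero by blast
qed

lemma functional_exists:
  assumes "S \<subseteq> A" "card S = n"
  shows "\<exists>l. l \<noteq> 0 \<and> (\<forall>s\<in>S. cdot l s = 0) \<and> (\<forall>a\<in>A - S. cdot l a \<noteq> 0)"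
proof -
  have "finite S" using assms(1) finite_A finite_subset by blast
  then obtain l where "l \<noteq> 0" "\<And>s. s \<in> S \<Longrightarrow> cdot l s = 0"
    using annihilating_functional_exists[of S] assms CARD_eq by auto
  with functional_nonzero[OF assms] show ?thesis by blast
qed

lemma partition_exists:
  assumes "a \<in> A"
  obtains S S' where "S \<subseteq> A" "S' \<subseteq> A" "card S = n" "card S' = n" "S \<union> S' = A - {a}"
proof -
  have c: "card (A - {a}) = 2 * n" using card_A assms finite_A by simp
  then obtain S where S: "S \<subseteq> A - {a}" "card S = n"
    by (metis le_add1 mult_2 obtain_subset_with_card_n)
  have "card (A - {a} - S) = n" using c S finite_A by (simp add: card_Diff_subset finite_subset)
  then show thesis using that[of S "A - {a} - S"] S by blast
qed

text \<open>The \<open>2 * n\<close> points other than \<open>a\<close> are split into halves, each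
  on a hyperplane that misses \<open>a\<close>. The product of the two equations is the quadric
  singling out \<open>a\<close>.\<close>

lemma separating_functionals_exist:
  assumes "a \<in> A"
  obtains l m where "cdot l a \<noteq> 0" "cdot m a \<noteq> 0"
    "\<And>x. x \<in> A - {a} \<Longrightarrow> cdot l x * cdot m x = 0"
proof -
  obtain S S' where S: "S \<subseteq> A" "card S = n" and S': "S' \<subseteq> A" "card S' = n"
    and un: "S \<union> S' = A - {a}"
    using partition_exists[OF assms] .
  obtain l m where "\<forall>s\<in>S. cdot l s = 0" "\<forall>x\<in>A - S. cdot l x \<noteq> 0"
    "\<forall>s\<in>S'. cdot m s = 0" "\<forall>x\<in>A - S'. cdot m x \<noteq> 0"
    using functional_exists[OF S] functional_exists[OF S'] by blast
  then show thesis using that[of l m] un assms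
    by (metis Diff_iff Un_iff insertI1 mult_eq_0_iff)
qed

end

section \<open>Two decompositions of a quartic\<close>

text \<open>Points are given by representing vectors. In \<open>not_proportional\<close>, the case
  \<open>c = 0\<close> also makes these vectors nonzero.\<close>

locale two_quartic_decompositions = points_in_general_position A n
  for A :: "(complex ^ 'n) set" and n +
  fixes B :: "(complex ^ 'n) set" and \<alpha> \<beta> :: "complex ^ 'n \<Rightarrow> complex"
  assumes n_pos: "n \<ge> 1"
    and finite_B: "finite B" and card_B_le: "card B \<le> 2 * n + 1" and B_neq: "B \<noteq> A"
    and \<alpha>_nonzero: "\<And>a. a \<in> A \<Longrightarrow> \<alpha> a \<noteq> 0"
    and moments: "\<And>p q r s. (\<Sum>a\<in>A. \<alpha> a * (cdot p a * cdot q a * cdot r a * cdot s a)) =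
      (\<Sum>b\<in>B. \<beta> b * (cdot p b * cdot q b * cdot r b * cdot s b))"
    and not_proportional: "\<And>v w c. v \<in> A \<union> B \<Longrightarrow> w \<in> A \<union> B \<Longrightarrow> v \<noteq> w \<Longrightarrow> v \<noteq> c *s w"
begin

text \<open>\<open>E a\<close> is the quadric that is 1 at \<open>a\<close> and 0 on the rest of
  \<open>A\<close>. In the quartic moments of \<open>E a\<close> times another quadric, only the
  term at \<open>a\<close> survives on the side of \<open>A\<close>.\<close>

lemma interpolation_data_exist:
  "\<exists>E. (\<forall>a\<in>A. \<forall>l m. (\<Sum>b\<in>B. \<beta> b * E a b * (cdot l b * cdot m b)) = \<alpha> a * (cdot l a * cdot m a)) \<and>
    (\<forall>a\<in>A. \<forall>a'\<in>A. (\<Sum>b\<in>B. \<beta> b * E a b * E a' b) = (if a = a' then \<alpha> a else 0))"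
proof -
  have "\<forall>a\<in>A. \<exists>l m. cdot l a \<noteq> 0 \<and> cdot m a \<noteq> 0 \<and> (\<forall>x\<in>A - {a}. cdot l x * cdot m x = 0)"
    using separating_functionals_exist by metis
  then obtain l m where lm: "\<And>a. a \<in> A \<Longrightarrow> cdot (l a) a \<noteq> 0" "\<And>a. a \<in> A \<Longrightarrow> cdot (m a) a \<noteq> 0"
    "\<And>a x. a \<in> A \<Longrightarrow> x \<in> A - {a} \<Longrightarrow> cdot (l a) x * cdot (m a) x = 0"
    by metis
  define E where "E a v = cdot (l a) v * cdot (m a) v / (cdot (l a) a * cdot (m a) a)" for a v
  have E_A: "E a a' = (if a = a' then 1 else 0)" if "a \<in> A" "a' \<in> A" for a a'
    using lm[OF that(1)] that by (auto simp: E_def)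
  have *: "(\<Sum>b\<in>B. \<beta> b * E a b * (cdot p b * cdot q b)) = \<alpha> a * (cdot p a * cdot q a)"
    if a: "a \<in> A" for a p q
  proof -
    have "(\<Sum>b\<in>S. \<gamma> b * E a b * (cdot p b * cdot q b)) =
        (\<Sum>b\<in>S. \<gamma> b * (cdot (l a) b * cdot (m a) b * cdot p b * cdot q b)) /
          (cdot (l a) a * cdot (m a) a)" for S \<gamma>
      by (simp add: E_def sum_divide_distrib mult.assoc)
    then have "(\<Sum>b\<in>B. \<beta> b * E a b * (cdot p b * cdot q b)) =
        (\<Sum>b\<in>A. \<alpha> b * E a b * (cdot p b * cdot q b))"
      by (simp add: moments)
    also have "\<dots> = (\<Sum>b\<in>A. if b = a then \<alpha> a * (cdot p a * cdot q a) else 0)"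
      using E_A a by (intro sum.cong) auto
    finally show ?thesis using a finite_A by simp
  qed
  moreover have "(\<Sum>b\<in>B. \<beta> b * E a b * E a' b) = (if a = a' then \<alpha> a else 0)"
    if "a \<in> A" "a' \<in> A" for a a'
  proof -
    have "(\<Sum>b\<in>B. \<beta> b * E a b * E a' b) =
        (\<Sum>b\<in>B. \<beta> b * E a b * (cdot (l a') b * cdot (m a') b)) / (cdot (l a') a' * cdot (m a') a')"
      by (simp add: E_def[of a'] sum_divide_distrib)
    also have "\<dots> = \<alpha> a * E a' a" using *[OF that(1)] by (simp add: E_def[of a'])
    finally show ?thesis using E_A that by auto
  qed
  ultimately show ?thesis by blast
qed

text \<open>On \<open>B\<close>, \<open>E a b\<close> turns out to be the coefficient of \<open>\<nu>\<^sub>2(a)\<close> in the expansion of \<open>\<nu>\<^sub>2(b)\<close>;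
  only its values at points of \<open>B\<close> are specified.\<close>

definition E :: "complex ^ 'n \<Rightarrow> complex ^ 'n \<Rightarrow> complex" where
  "E = (SOME E. (\<forall>a\<in>A. \<forall>l m. (\<Sum>b\<in>B. \<beta> b * E a b * (cdot l b * cdot m b)) = \<alpha> a * (cdot l a * cdot m a)) \<and>
    (\<forall>a\<in>A. \<forall>a'\<in>A. (\<Sum>b\<in>B. \<beta> b * E a b * E a' b) = (if a = a' then \<alpha> a else 0)))"

lemma E_moments: "a \<in> A \<Longrightarrow> (\<Sum>b\<in>B. \<beta> b * E a b * (cdot l b * cdot m b)) = \<alpha> a * (cdot l a * cdot m a)"
  and E_orthogonal: "a \<in> A \<Longrightarrow> a' \<in> A \<Longrightarrow> (\<Sum>b\<in>B. \<beta> b * E a b * E a' b) = (if a = a' then \<alpha> a else 0)"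
  using someI_ex[OF interpolation_data_exist] unfolding E_def[symmetric] by blast+

section \<open>The square matrix of interpolation coefficients\<close>

lemma E_right_inverse:
  assumes "a \<in> A" "a' \<in> A"
  shows "(\<Sum>b\<in>B. E a b * (\<beta> b * E a' b / \<alpha> a')) = (if a = a' then 1 else 0)"
proof -
  have "(\<Sum>b\<in>B. E a b * (\<beta> b * E a' b / \<alpha> a')) = (\<Sum>b\<in>B. \<beta> b * E a b * E a' b) / \<alpha> a'"
    by (simp add: sum_divide_distrib algebra_simps)
  then show ?thesis using E_orthogonal[OF assms] \<alpha>_nonzero assms by auto
qed

lemma card_B: "card B = 2 * n + 1"
  using right_inverse_imp_card_le[OF finite_A finite_B E_right_inverse] card_A card_B_le by simp

text \<open>A point with zero coefficient could be dropped from \<open>B\<close>, leaving too few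
  columns for a right inverse.\<close>

lemma \<beta>_nonzero:
  assumes "b \<in> B"
  shows "\<beta> b \<noteq> 0"
proof
  assume "\<beta> b = 0"
  then have "card A \<le> card (B - {b})"
    using E_right_inverse assms finite_A finite_B
    by (intro right_inverse_imp_card_le[of A "B - {b}" E "\<lambda>a' b. \<beta> b * E a' b / \<alpha> a'"])
       (simp_all add: sum.remove[of B b])
  then show False using card_A card_B assms finite_B by simp
qed

text \<open>The interpolation error, weighted by \<open>\<beta>\<close>, is in the kernel of the
  matrix \<open>E\<close>, which is square and has a right inverse. Hence the error vanishes on
  \<open>B\<close>.\<close>

lemma interpolation:
  assumes b: "b \<in> B"
  shows "cdot l b * cdot m b = (\<Sum>a\<in>A. cdot l a * cdot m a * E a b)"
proof -
  let ?f = "\<lambda>b. \<beta> b * (cdot l b * cdot m b - (\<Sum>a\<in>A. cdot l a * cdot m a * E a b))"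
  have "(\<Sum>b\<in>B. E a b * ?f b) = 0" if a: "a \<in> A" for a
  proof -
    have "(\<Sum>b\<in>B. E a b * ?f b) = (\<Sum>b\<in>B. \<beta> b * E a b * (cdot l b * cdot m b)) -
        (\<Sum>b\<in>B. \<Sum>a'\<in>A. cdot l a' * cdot m a' * (\<beta> b * E a b * E a' b))"
      by (simp add: right_diff_distrib sum_subtractf sum_distrib_left ac_simps)
    also have "(\<Sum>b\<in>B. \<Sum>a'\<in>A. cdot l a' * cdot m a' * (\<beta> b * E a b * E a' b)) =
        (\<Sum>a'\<in>A. cdot l a' * cdot m a' * (\<Sum>b\<in>B. \<beta> b * E a b * E a' b))"
      by (subst sum.swap) (simp add: sum_distrib_left)
    also have "\<dots> = (\<Sum>a'\<in>A. if a' = a then \<alpha> a * (cdot l a * cdot m a) else 0)"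
      using E_orthogonal a by (intro sum.cong) auto
    also have "\<dots> = \<alpha> a * (cdot l a * cdot m a)" using a finite_A by simp
    finally show ?thesis using E_moments[OF a] by simp
  qed
  then have "?f b = 0"
    using E_right_inverse card_A card_B_le b
    by (intro right_inverse_imp_trivial_kernel[OF finite_A finite_B, of E "\<lambda>a' b. \<beta> b * E a' b / \<alpha> a'" ?f])
       simp_all
  then show ?thesis using \<beta>_nonzero[OF b] by simp
qed

lemma interpolation_single:
  assumes "b \<in> B" "a \<in> A" "\<And>x. x \<in> A - {a} \<Longrightarrow> cdot l x * cdot m x = 0"
  shows "cdot l b * cdot m b = cdot l a * cdot m a * E a b"
proof -
  have "(\<Sum>x\<in>A. cdot l x * cdot m x * E x b) = (\<Sum>x\<in>A. if x = a then cdot l a * cdot m a * E a b else 0)"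
    using assms(3) by (intro sum.cong) auto
  then show ?thesis using interpolation[OF assms(1)] assms(2) finite_A by simp
qed

text \<open>If \<open>l\<close> vanishes at \<open>b\<close>, then \<open>b\<close> lies in the span of \<open>S\<close> and, for every \<open>a \<in> A - S\<close>, on one
  of the two hyperplanes of every splitting of \<open>A - {a}\<close>. Exchanging a point \<open>s \<in> S\<close> that
  contributes to \<open>b\<close> with points of \<open>A - S\<close> yields so many hyperplanes through \<open>b\<close> and \<open>s\<close> that
  \<open>b\<close> is proportional to \<open>s\<close>.\<close>

lemma functional_nonzero_at_new_point:
  assumes b: "b \<in> B - A" and S: "S \<subseteq> A" "card S = n"
    and l: "\<And>s. s \<in> S \<Longrightarrow> cdot l s = 0" "l \<noteq> 0"
  shows "cdot l b \<noteq> 0"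
proof
  assume lb: "cdot l b = 0"
  define R where "R = A - S"
  have fin: "finite S" "finite R" using S finite_A finite_subset by (auto simp: R_def)
  have card_R: "card R = Suc n" using S fin card_A by (simp add: R_def card_Diff_subset)
  have l_R: "cdot l r \<noteq> 0" if "r \<in> R" for r
    using functional_nonzero[OF S l] that by (simp add: R_def)
  have E_zero: "E r b = 0" if r: "r \<in> R" for r
  proof -
    have c: "R - {r} \<subseteq> A" "card (R - {r}) = n" using r card_R fin by (auto simp: R_def)
    obtain m where m: "\<forall>s\<in>R - {r}. cdot m s = 0" "\<forall>a\<in>A - (R - {r}). cdot m a \<noteq> 0"
      using functional_exists[OF c] by blast
    \<comment> \<open>Here \<open>A - {r}\<close> is split into \<open>S\<close> and
      \<open>R - {r}\<close>.\<close>
    have "cdot l b * cdot m b = cdot l r * cdot m r * E r b"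
    proof (rule interpolation_single)
      show "cdot l x * cdot m x = 0" if "x \<in> A - {r}" for x
        using l(1)[of x] m(1) that by (cases "x \<in> S") (auto simp: R_def)
    qed (use b r in \<open>auto simp: R_def\<close>)
    moreover have "cdot m r \<noteq> 0" using m(2) r by (auto simp: R_def)
    ultimately show ?thesis using lb l_R[OF r] by simp
  qed
  have "R \<noteq> {}" using card_R by auto
  then obtain r where r: "r \<in> R" by blast
  obtain x where x: "b = (\<Sum>s\<in>insert r S. x s *s s)"
    using expansion[of "insert r S" b] r S fin by (auto simp: R_def)
  have "cdot l b = x r * cdot l r"
    unfolding x using fin l r by (intro cdot_combination_single) (auto simp: R_def)
  then have xr: "x r = 0" using lb l_R[OF r] by simp
  have "\<exists>s\<in>S. x s \<noteq> 0"
  proof (rule ccontr)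
    assume "\<not> (\<exists>s\<in>S. x s \<noteq> 0)"
    then have "b = 0 *s r" unfolding x using xr by (auto intro!: sum.neutral)
    then show False using not_proportional[of b r 0] b r by (auto simp: R_def)
  qed
  then obtain s where s: "s \<in> S" "x s \<noteq> 0" by blast
  \<comment> \<open>A second basis, meeting \<open>S\<close> only in \<open>s\<close>; the aim is
    that all coefficients of \<open>b\<close> in it vanish except the one at
    \<open>s\<close>.\<close>
  define T where "T = insert s (R - {r})"
  have T: "T \<subseteq> A" "card T = Suc n" "finite T"
    using s r card_R fin S by (auto simp: T_def R_def)
  obtain y where y: "b = (\<Sum>t\<in>T. y t *s t)" using expansion[OF T(1,2), of b] by blast
  have y_zero: "y r' = 0" if r': "r' \<in> R - {r}" for r'
  proof -
    have c1: "insert r (S - {s}) \<subseteq> A" "card (insert r (S - {s})) = n"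
      using S fin s r n_pos by (auto simp: R_def)
    \<comment> \<open>The sets \<open>insert r (S - {s})\<close> and \<open>T - {r'}\<close> split
      \<open>A - {r'}\<close>. The first hyperplane misses \<open>b\<close> because
      \<open>x s\<close> is nonzero, so the second must contain \<open>b\<close>.\<close>
    obtain h where h: "\<forall>v\<in>insert r (S - {s}). cdot h v = 0" "\<forall>a\<in>A - insert r (S - {s}). cdot h a \<noteq> 0"
      using functional_exists[OF c1] by blast
    have "cdot h b = x s * cdot h s"
      unfolding x using fin h s by (intro cdot_combination_single) auto
    moreover have "cdot h s \<noteq> 0" using h(2) s S r by (auto simp: R_def)
    ultimately have hb: "cdot h b \<noteq> 0" using s by simp
    have c2: "T - {r'} \<subseteq> A" "card (T - {r'}) = n" using T r' by (auto simp: T_def)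
    obtain m where m: "\<forall>v\<in>T - {r'}. cdot m v = 0" "\<forall>a\<in>A - (T - {r'}). cdot m a \<noteq> 0"
      using functional_exists[OF c2] by blast
    have "cdot h b * cdot m b = cdot h r' * cdot m r' * E r' b"
    proof (rule interpolation_single)
      show "cdot h v * cdot m v = 0" if "v \<in> A - {r'}" for v
        using h(1) m(1) that by (auto simp: T_def R_def)
    qed (use b r' in \<open>auto simp: R_def\<close>)
    then have "cdot m b = 0" using hb E_zero r' by simp
    moreover have "cdot m b = y r' * cdot m r'"
      unfolding y using T m r' by (intro cdot_combination_single) (auto simp: T_def)
    moreover have "cdot m r' \<noteq> 0" using m(2) r' by (auto simp: R_def)
    ultimately show ?thesis by simp
  qed
  have "b = y s *s s"
  proof -
    have "(\<Sum>t\<in>R - {r}. y t *s t) = 0" using y_zero by (intro sum.neutral) auto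
    moreover have "s \<notin> R" using s by (simp add: R_def)
    ultimately show ?thesis unfolding y T_def using fin by simp
  qed
  moreover have "b \<noteq> y s *s s"
    by (rule not_proportional) (use b s(1) S(1) in auto)
  ultimately show False by simp
qed

text \<open>The new point \<open>b\<close> lies on neither hyperplane of a splitting of
  \<open>A - {a}\<close>, so the quadric singling out \<open>a\<close> does not vanish at
  \<open>b\<close>.\<close>

lemma E_nonzero:
  assumes b: "b \<in> B - A" and a: "a \<in> A"
  shows "E a b \<noteq> 0"
proof -
  obtain S S' where S: "S \<subseteq> A" "card S = n" and S': "S' \<subseteq> A" "card S' = n"
    and un: "S \<union> S' = A - {a}"
    using partition_exists[OF a] .
  obtain l m where l: "l \<noteq> 0" "\<forall>s\<in>S. cdot l s = 0" and m: "m \<noteq> 0" "\<forall>s\<in>S'. cdot m s = 0"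
    using functional_exists[OF S] functional_exists[OF S'] by blast
  have "cdot l b \<noteq> 0" "cdot m b \<noteq> 0"
    using functional_nonzero_at_new_point[OF b S] functional_nonzero_at_new_point[OF b S'] l m by auto
  moreover have "cdot l b * cdot m b = cdot l a * cdot m a * E a b"
    using b a l m un by (intro interpolation_single) auto
  ultimately show ?thesis by auto
qed

lemma E_on_common_point:
  assumes "b \<in> B" "b \<in> A" "a \<in> A" "b \<noteq> a"
  shows "E a b = 0"
proof -
  obtain l m where lm: "cdot l a \<noteq> 0" "cdot m a \<noteq> 0"
    "\<And>x. x \<in> A - {a} \<Longrightarrow> cdot l x * cdot m x = 0"
    using separating_functionals_exist[OF assms(3)] by metis
  have "cdot l b * cdot m b = cdot l a * cdot m a * E a b"
    using assms lm by (intro interpolation_single) auto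
  moreover have "cdot l b * cdot m b = 0" using assms lm(3)[of b] by blast
  ultimately show ?thesis using lm by simp
qed

text \<open>If \<open>b\<close> were the only new point, the orthogonality of \<open>E a\<close> and
  \<open>E a'\<close> would reduce to its term at \<open>b\<close>, which is nonzero: a common point
  differs from \<open>a\<close> or from \<open>a'\<close>, so its term vanishes.\<close>

lemma two_new_points_exist:
  obtains b b' where "b \<in> B - A" "b' \<in> B - A" "b \<noteq> b'"
proof -
  have "\<not> B \<subseteq> A" using B_neq card_A card_B finite_A by (metis card_subset_eq)
  then obtain b where b: "b \<in> B - A" by blast
  have "\<exists>b'\<in>B - A. b \<noteq> b'"
  proof (rule ccontr)
    assume "\<not> (\<exists>b'\<in>B - A. b \<noteq> b')"
    then have only: "b' \<in> A" if "b' \<in> B - {b}" for b' using that by auto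
    have "\<exists>a a'. a \<in> A \<and> a' \<in> A \<and> a \<noteq> a'"
      using card_A n_pos card_le_Suc0_iff_eq[OF finite_A] by auto
    then obtain a a' where a: "a \<in> A" "a' \<in> A" "a \<noteq> a'" by blast
    have "(\<Sum>b'\<in>B - {b}. \<beta> b' * E a b' * E a' b') = 0"
    proof (intro sum.neutral ballI)
      fix b' assume "b' \<in> B - {b}"
      then show "\<beta> b' * E a b' * E a' b' = 0"
        using E_on_common_point[of b' a] E_on_common_point[of b' a'] only a by auto
    qed
    moreover have "(\<Sum>b'\<in>B. \<beta> b' * E a b' * E a' b') = 0" using E_orthogonal a by simp
    ultimately have "\<beta> b * E a b * E a' b = 0" using b finite_B by (simp add: sum.remove[of B b])
    then show False using E_nonzero[OF b] \<beta>_nonzero b a by auto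
  qed
  then show thesis using b that by blast
qed

end

section \<open>Coordinates given by points of \<open>A\<close>\<close>

text \<open>\<open>L\<close> is the basis dual to the frame \<open>f\<close>, and \<open>u\<close>
  is the equation of the hyperplane through the remaining \<open>n\<close> points of
  \<open>A\<close>.\<close>

locale framed_quartic_decompositions = two_quartic_decompositions A n B \<alpha> \<beta>
  for A :: "(complex ^ 'n) set" and n B \<alpha> \<beta> +
  fixes f L :: "'n \<Rightarrow> complex ^ 'n" and u :: "complex ^ 'n"
  assumes inj_f: "inj f" and f_in: "range f \<subseteq> A"
    and L_f: "\<And>i j. cdot (L i) (f j) = (if i = j then 1 else 0)"
    and u_nonzero: "u \<noteq> 0" and u_zero: "\<And>p. p \<in> A - range f \<Longrightarrow> cdot u p = 0"
begin

section \<open>Coordinates with respect to the frame\<close>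

abbreviation (input) x where "x i v \<equiv> cdot (L i) v"

lemma card_range_f: "card (range f) = Suc n"
  using card_image[OF inj_f] CARD_eq by simp

lemma card_rest: "card (A - range f) = n"
  using card_range_f card_A f_in by (simp add: card_Diff_subset)

lemma frame_expansion: "v = (\<Sum>i\<in>UNIV. x i v *s f i)"
proof -
  obtain y where "v = (\<Sum>s\<in>range f. y s *s s)"
    using expansion[OF f_in card_range_f] by blast
  then have v: "v = (\<Sum>i\<in>UNIV. y (f i) *s f i)" using inj_f by (simp add: sum.reindex)
  have "x i v = y (f i)" for i
    by (subst v) (simp add: cdot_sum_right cdot_scale_right L_f if_distrib cong: if_cong)
  then show ?thesis using v by simp
qed

lemma coordinates_eqI: "(\<And>i. x i v = x i w) \<Longrightarrow> v = w"
  by (subst frame_expansion[of v], subst frame_expansion[of w]) simp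

lemma cdot_expansion: "cdot l v = (\<Sum>i\<in>UNIV. cdot l (f i) * x i v)"
  by (subst frame_expansion[of v]) (simp add: cdot_sum_right cdot_scale_right mult.commute)

lemma coordinate_hyperplane:
  shows "range f - {f i} \<subseteq> A" "card (range f - {f i}) = n" "L i \<noteq> 0"
    "s \<in> range f - {f i} \<Longrightarrow> x i s = 0"
proof -
  show "L i \<noteq> 0" using L_f[of i i] by auto
  show "card (range f - {f i}) = n" using card_range_f by simp
qed (use f_in L_f in auto)

lemma x_rest_nonzero: "p \<in> A - range f \<Longrightarrow> x i p \<noteq> 0"
  by (rule functional_nonzero[OF coordinate_hyperplane(1,2,4,3)]) auto

lemma x_new_nonzero: "b \<in> B - A \<Longrightarrow> x i b \<noteq> 0"
  by (rule functional_nonzero_at_new_point[OF _ coordinate_hyperplane(1,2,4,3)]) auto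

lemma u_frame_nonzero: "cdot u (f i) \<noteq> 0"
  by (rule functional_nonzero[OF _ card_rest u_zero u_nonzero]) (use f_in in auto)

lemma u_new_nonzero: "b \<in> B - A \<Longrightarrow> cdot u b \<noteq> 0"
  by (rule functional_nonzero_at_new_point[OF _ _ card_rest u_zero u_nonzero]) auto

text \<open>The product of \<open>u\<close> and \<open>L i\<close> vanishes on \<open>A\<close>
  except at \<open>f i\<close>: \<open>u\<close> kills the remaining points and \<open>L i\<close>
  the other frame points.\<close>

lemma u_E:
  assumes "b \<in> B"
  shows "cdot u b * x i b = cdot u (f i) * E (f i) b"
proof -
  have "cdot u b * x i b = cdot u (f i) * x i (f i) * E (f i) b"
  proof (rule interpolation_single[OF assms])
    show "cdot u y * x i y = 0" if "y \<in> A - {f i}" for y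
      using that u_zero[of y] L_f by (cases "y \<in> range f") (auto split: if_splits)
  qed (use f_in in auto)
  then show ?thesis by (simp add: L_f)
qed

lemma coordinate_products:
  assumes b: "b \<in> B"
  shows "x i b * x j b = (\<Sum>p\<in>A - range f. x i p * x j p * E p b) + (if i = j then E (f i) b else 0)"
proof -
  have "x i b * x j b = (\<Sum>p\<in>A - range f. x i p * x j p * E p b) + (\<Sum>p\<in>range f. x i p * x j p * E p b)"
    unfolding interpolation[OF b] by (rule sum.subset_diff[OF f_in finite_A])
  also have "(\<Sum>p\<in>range f. x i p * x j p * E p b) = (\<Sum>k\<in>UNIV. x i (f k) * x j (f k) * E (f k) b)"
    using inj_f by (simp add: sum.reindex)
  also have "\<dots> = (\<Sum>k\<in>UNIV. if k = i then (if i = j then E (f i) b else 0) else 0)"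
    by (intro sum.cong) (auto simp: L_f)
  finally show ?thesis by simp
qed

text \<open>In matrix notation \<open>b b\<^sup>T = \<Sum>\<^sub>p E\<^sub>p p p\<^sup>T + D\<close> with \<open>D\<close> diagonal;
  here both sides are applied to the vector \<open>y\<close>.\<close>

lemma coordinate_products_applied:
  assumes b: "b \<in> B"
  shows "x i b * (\<Sum>j\<in>UNIV. x j b * y j) =
    (\<Sum>p\<in>A - range f. E p b * (\<Sum>j\<in>UNIV. x j p * y j) * x i p) + E (f i) b * y i"
proof -
  have "x i b * (\<Sum>j\<in>UNIV. x j b * y j) = (\<Sum>j\<in>UNIV. (x i b * x j b) * y j)"
    by (simp add: sum_distrib_left mult.assoc)
  also have "\<dots> = (\<Sum>j\<in>UNIV. \<Sum>p\<in>A - range f. x i p * x j p * E p b * y j) +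
      (\<Sum>j\<in>UNIV. if i = j then E (f i) b * y i else 0)"
    unfolding coordinate_products[OF b]
    by (simp add: distrib_right sum.distrib sum_distrib_right if_distrib[of "\<lambda>z. z * _"] cong: if_cong)
  also have "(\<Sum>j\<in>UNIV. \<Sum>p\<in>A - range f. x i p * x j p * E p b * y j) =
      (\<Sum>p\<in>A - range f. E p b * (\<Sum>j\<in>UNIV. x j p * y j) * x i p)"
    by (subst sum.swap) (simp add: sum_distrib_left sum_distrib_right mult_ac)
  finally show ?thesis by simp
qed

text \<open>Apply the matrix identity to the vector with entries
  \<open>cdot u (f j) * x j p / x j b\<close>. The left side becomes a multiple of
  \<open>cdot u p = 0\<close>, and by \<open>u_E\<close> the diagonal part becomes
  \<open>cdot u b\<close> times \<open>p\<close>. What is left is a relation between the independent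
  points of \<open>A - range f\<close>.\<close>

lemma weighted_products:
  assumes b: "b \<in> B - A" and p: "p \<in> A - range f" and q: "q \<in> A - range f"
  shows "E q b * (\<Sum>j\<in>UNIV. x j q * (cdot u (f j) * x j p / x j b)) = (if q = p then - cdot u b else 0)"
proof -
  define y where "y j = cdot u (f j) * x j p / x j b" for j
  define d where "d q = E q b * (\<Sum>j\<in>UNIV. x j q * y j) + (if q = p then cdot u b else 0)" for q
  have "(\<Sum>j\<in>UNIV. x j b * y j) = cdot u p"
    using x_new_nonzero[OF b] by (simp add: y_def cdot_expansion[of u p])
  then have by0: "(\<Sum>j\<in>UNIV. x j b * y j) = 0" using u_zero[OF p] by simp
  have Ey: "E (f i) b * y i = cdot u b * x i p" for i
    using u_E[of b i] b x_new_nonzero[OF b, of i] by (simp add: y_def field_simps)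
  have "(\<Sum>q\<in>A - range f. d q *s q) = 0"
  proof (rule coordinates_eqI)
    fix i
    have "x i (\<Sum>q\<in>A - range f. d q *s q) =
        (\<Sum>q\<in>A - range f. E q b * (\<Sum>j\<in>UNIV. x j q * y j) * x i q) +
        (\<Sum>q\<in>A - range f. if q = p then cdot u b * x i p else 0)"
      unfolding cdot_sum_right cdot_scale_right d_def
      by (simp add: distrib_right sum.distrib if_distrib[of "\<lambda>z. z * _"] cong: if_cong)
    also have "\<dots> = x i b * (\<Sum>j\<in>UNIV. x j b * y j)"
      using coordinate_products_applied[of b i y] b p finite_A Ey by simp
    finally show "x i (\<Sum>q\<in>A - range f. d q *s q) = x i 0" using by0 by simp
  qed
  moreover have "vec.independent (A - range f)" using card_rest by (intro independent) auto
  ultimately have "d q = 0"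
    using q finite_A vec.independentD[of "A - range f" "A - range f" d q] by auto
  then show ?thesis by (simp add: d_def y_def eq_neg_iff_add_eq_0 split: if_splits)
qed

text \<open>A combination \<open>y\<close> of the weight vectors of \<open>b\<close> and
  \<open>b'\<close> is orthogonal to all of \<open>A - range f\<close>. The matrix identity then
  retains only its diagonal part, which forces \<open>y\<close> to be proportional to
  \<open>u\<close>; dividing by \<open>u\<close> and \<open>p\<close> gives the claim.\<close>

lemma reciprocal_rest_point:
  assumes b: "b \<in> B - A" and b': "b' \<in> B - A" and "b \<noteq> b'" and p: "p \<in> A - range f"
  obtains s t where "\<And>i. 1 / x i p = s / x i b + t / x i b'"
proof -
  \<comment> \<open>The factors are crossed: pairing \<open>p\<close> with the weights of
    \<open>b\<close> and \<open>b'\<close> gives \<open>- c'\<close> and \<open>- c\<close>, so the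
    two contributions to \<open>y\<close> cancel.\<close>
  define c where "c = cdot u b' / E p b'"
  define c' where "c' = cdot u b / E p b"
  have E: "E q b \<noteq> 0" "E q b' \<noteq> 0" if "q \<in> A - range f" for q using E_nonzero b b' that by auto
  have c: "c \<noteq> 0" "c' \<noteq> 0" using E[OF p] u_new_nonzero b b' by (auto simp: c_def c'_def)
  define w where "w j v = cdot u (f j) * x j p / x j v" for j v
  define y where "y j = c * w j b - c' * w j b'" for j
  have wp: "(\<Sum>j\<in>UNIV. x j q * w j b) = (if q = p then - c' else 0)"
    "(\<Sum>j\<in>UNIV. x j q * w j b') = (if q = p then - c else 0)" if "q \<in> A - range f" for q
    using weighted_products[OF b p that] weighted_products[OF b' p that] E[OF that]
    by (auto simp: w_def c_def c'_def field_simps split: if_splits)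
  have "(\<Sum>j\<in>UNIV. x j q * y j) = 0" if "q \<in> A - range f" for q
  proof -
    have "(\<Sum>j\<in>UNIV. x j q * y j) = c * (\<Sum>j\<in>UNIV. x j q * w j b) - c' * (\<Sum>j\<in>UNIV. x j q * w j b')"
      by (simp add: y_def right_diff_distrib sum_subtractf sum_distrib_left mult_ac)
    then show ?thesis using wp[OF that] by simp
  qed
  then have yi: "x i b * (\<Sum>j\<in>UNIV. x j b * y j) = E (f i) b * y i" for i
    using coordinate_products_applied[of b i y] b by simp
  define z where "z = (\<Sum>j\<in>UNIV. x j b * y j) / cdot u b"
  have z: "x i p * (c / x i b - c' / x i b') = z" for i
  proof -
    have "x i b * (cdot u b * y i) = cdot u (f i) * (E (f i) b * y i)"
      using u_E[of b i] b by (simp add: mult.left_commute flip: mult.assoc)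
    also have "\<dots> = x i b * (cdot u (f i) * (cdot u b * z))"
      using u_new_nonzero[OF b] by (simp add: z_def flip: yi)
    finally have "y i = cdot u (f i) * z"
      using x_new_nonzero[OF b, of i] u_new_nonzero[OF b] by simp
    moreover have "y i = cdot u (f i) * (x i p * (c / x i b - c' / x i b'))"
      by (simp add: y_def w_def algebra_simps)
    ultimately show ?thesis using u_frame_nonzero[of i] by simp
  qed
  have "z \<noteq> 0"
  proof
    assume "z = 0"
    have "b' = (c' / c) *s b"
    proof (rule coordinates_eqI)
      fix i
      have "c / x i b = c' / x i b'" using z[of i] \<open>z = 0\<close> x_rest_nonzero[OF p, of i] by simp
      then show "x i b' = x i ((c' / c) *s b)"
        using c x_new_nonzero[OF b, of i] x_new_nonzero[OF b', of i]
        by (simp add: cdot_scale_right field_simps)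
    qed
    then show False using not_proportional[of b' b] b b' \<open>b \<noteq> b'\<close> by auto
  qed
  show thesis
  proof (rule that[of "c / z" "- c' / z"])
    fix i
    define D where "D = c / x i b - c' / x i b'"
    have "x i p * D = z" using z by (simp add: D_def)
    then have "1 / x i p = D / z" using \<open>z \<noteq> 0\<close> by auto
    then show "1 / x i p = c / z / x i b + - c' / z / x i b'"
      by (simp add: D_def diff_divide_distrib mult.commute)
  qed
qed

text \<open>The reciprocal of one point \<open>p\<close> of \<open>A - range f\<close> lies on the
  line for \<open>b, b'\<close> and on the line for \<open>b, v\<close>. Comparing the two
  expressions solves for the reciprocal of \<open>v\<close>.\<close>

lemma reciprocal_new_point:
  assumes b: "b \<in> B - A" and b': "b' \<in> B - A" and "b \<noteq> b'" and v: "v \<in> B - A"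
  obtains s t where "\<And>i. 1 / x i v = s / x i b + t / x i b'"
proof (cases "v = b")
  case True
  then show thesis by (intro that[of 1 0]) simp
next
  case False
  have "A - range f \<noteq> {}" using card_rest n_pos by (metis card.empty not_one_le_zero)
  then obtain p where p: "p \<in> A - range f" by blast
  obtain s t where st: "\<And>i. 1 / x i p = s / x i b + t / x i b'"
    using reciprocal_rest_point[OF b b' \<open>b \<noteq> b'\<close> p] by metis
  obtain s' t' where st': "\<And>i. 1 / x i p = s' / x i b + t' / x i v"
    using reciprocal_rest_point[OF b v _ p] False by metis
  have "t' \<noteq> 0"
  proof
    assume "t' = 0"
    have "b = s' *s p"
    proof (rule coordinates_eqI)
      fix i
      show "x i b = x i (s' *s p)"
        using st'[of i] \<open>t' = 0\<close> x_new_nonzero[OF b, of i] x_rest_nonzero[OF p, of i]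
        by (simp add: cdot_scale_right field_simps)
    qed
    moreover have "b \<noteq> s' *s p" by (rule not_proportional) (use b p in auto)
    ultimately show False by simp
  qed
  show thesis
  proof (rule that[of "(s - s') / t'" "t / t'"])
    fix i
    have "t' * (1 / x i v) = (s - s') * (1 / x i b) + t * (1 / x i b')"
      using st[of i] st'[of i] by (simp add: algebra_simps diff_divide_distrib)
    then have "1 / x i v = ((s - s') * (1 / x i b) + t * (1 / x i b')) / t'"
      using \<open>t' \<noteq> 0\<close> by (metis nonzero_mult_div_cancel_left)
    then show "1 / x i v = (s - s') / t' / x i b + t / t' / x i b'"
      by (simp add: add_divide_distrib mult.commute)
  qed
qed

text \<open>If this minor vanished, the functional \<open>h\<close> that kills \<open>b\<close>
  would kill every point of \<open>A - range f\<close> as well. Then \<open>b\<close> would lie on a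
  hyperplane spanned by points of \<open>A\<close>.\<close>

lemma new_points_independent_coordinates:
  assumes b: "b \<in> B - A" and b': "b' \<in> B - A" and "b \<noteq> b'" and "i \<noteq> j"
  shows "x i b * x j b' \<noteq> x j b * x i b'"
proof
  assume eq: "x i b * x j b' = x j b * x i b'"
  define h where "h = x j b *s L i + (- x i b) *s L j"
  have h: "cdot h v = x j b * x i v - x i b * x j v" for v
    unfolding h_def cdot_add_left cdot_scale_left by simp
  have "cdot h b \<noteq> 0"
  proof (rule functional_nonzero_at_new_point[OF b _ card_rest])
    show "h \<noteq> 0" using h[of "f i"] L_f \<open>i \<noteq> j\<close> x_new_nonzero[OF b, of j] by auto
    fix p assume p: "p \<in> A - range f"
    obtain s t where st: "\<And>i. 1 / x i p = s / x i b + t / x i b'"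
      using reciprocal_rest_point[OF b b' \<open>b \<noteq> b'\<close> p] by metis
    have "x i b / x i b' = x j b / x j b'"
      using eq x_new_nonzero[OF b'] by (simp add: field_simps)
    moreover have "x k b * (1 / x k p) = s + t * (x k b / x k b')" for k
      using st[of k] x_new_nonzero[OF b, of k] by (simp add: distrib_left)
    ultimately have "x i b * (1 / x i p) = x j b * (1 / x j p)" by metis
    then show "cdot h p = 0" using x_rest_nonzero[OF p] by (simp add: h field_simps)
  qed auto
  then show False by (simp add: h)
qed

lemma common_rational_normal_curve:
  "\<exists>C. rational_normal_curve C \<and> proj_point ` (A \<union> B) \<subseteq> C"
proof -
  obtain b b' where b: "b \<in> B - A" and b': "b' \<in> B - A" and "b \<noteq> b'"
    using two_new_points_exist .
  define \<phi> where "\<phi> i = 1 / x i b" for i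
  define \<psi> where "\<psi> i = 1 / x i b'" for i
  have indep: "\<phi> i * \<psi> j \<noteq> \<phi> j * \<psi> i" if "i \<noteq> j" for i j
    using new_points_independent_coordinates[OF b b' \<open>b \<noteq> b'\<close> that] x_new_nonzero[OF b] x_new_nonzero[OF b']
    by (simp add: \<phi>_def \<psi>_def field_simps)
  obtain e where e: "bij_betw e (UNIV :: 'n set) {..<CARD('n)}"
    using ex_bij_betw_finite_nat[of "UNIV :: 'n set"] by (auto simp: atLeast0LessThan)
  obtain g :: "complex ^ 'n ^ 'n" where g: "invertible g"
    "\<And>s t. g *v (\<chi> i. s ^ (CARD('n) - 1 - e i) * t ^ e i) = (\<chi> i. \<Prod>j\<in>UNIV - {i}. s * \<phi> j + t * \<psi> j)"
    using products_omitting_one_factor[of \<phi> \<psi> e, OF indep e] by blast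
  define M :: "complex ^ 'n ^ 'n" where "M = (\<chi> i j. f j $ i)"
  have M: "M *v w = (\<Sum>i\<in>UNIV. w $ i *s f i)" for w
    by (simp add: M_def vec_eq_iff matrix_vector_mult_def mult.commute)
  have M_x: "M *v (\<chi> i. x i v) = v" for v
    unfolding M by (subst (2) frame_expansion) simp
  have "invertible M"
  proof -
    have "surj ((*v) M)" using M_x by (rule surjI)
    then show ?thesis by (simp add: invertible_right_inverse matrix_right_invertible_surjective)
  qed
  \<comment> \<open>\<open>g\<close> maps the standard curve to the inverse Cremona image of the
    line through the reciprocals of \<open>b\<close> and \<open>b'\<close>; \<open>M\<close> passes
    from frame coordinates to the original ones.\<close>
  define C where "C = (\<lambda>P. (*v) (M ** g) ` P) ` standard_rational_normal_curve e"
  have "rational_normal_curve C"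
    unfolding rational_normal_curve_def C_def using invertible_mult[OF \<open>invertible M\<close> g(1)] e by blast
  moreover have in_C: "proj_point v \<in> C"
    if st: "(s, t) \<noteq> (0, 0)" and "k \<noteq> 0" and v: "\<And>i. x i v = k * (\<Prod>j\<in>UNIV - {i}. s * \<phi> j + t * \<psi> j)" for s t k v
  proof -
    let ?m = "\<chi> i. s ^ (CARD('n) - 1 - e i) * t ^ e i"
    have "(\<chi> i. x i v) = k *s (g *v ?m)" unfolding g v by (simp add: vec_eq_iff)
    then have "v = k *s ((M ** g) *v ?m)"
      using M_x[of v] by (simp add: vector_scalar_commute matrix_vector_mul_assoc)
    then have "proj_point v = (*v) (M ** g) ` proj_point ?m"
      using \<open>k \<noteq> 0\<close> by (simp add: proj_point_scale matrix_image_proj_point)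
    then show ?thesis unfolding C_def standard_rational_normal_curve_def using st by blast
  qed
  have reciprocal_in_C: "proj_point v \<in> C"
    if nz: "\<And>i. x i v \<noteq> 0" and st: "\<And>i. 1 / x i v = s / x i b + t / x i b'" for v s t
  \<comment> \<open>The product of all coordinates of \<open>v\<close> clears the
    denominators.\<close>
  proof (rule in_C[of s t "\<Prod>j\<in>UNIV. x j v"])
    fix i :: 'n
    have "1 / x i v \<noteq> 0" using nz by simp
    then show "(s, t) \<noteq> (0, 0)" using st[of i] by auto
  next
    fix i
    have "(\<Prod>j\<in>UNIV - {i}. s * \<phi> j + t * \<psi> j) = (\<Prod>j\<in>UNIV - {i}. 1 / x j v)"
      by (simp add: st \<phi>_def \<psi>_def)
    moreover have "(\<Prod>j\<in>UNIV. x j v) = x i v * (\<Prod>j\<in>UNIV - {i}. x j v)" by (simp add: prod.remove[of UNIV i])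
    moreover have "(\<Prod>j\<in>UNIV - {i}. x j v) \<noteq> 0" using nz by simp
    ultimately show "x i v = (\<Prod>j\<in>UNIV. x j v) * (\<Prod>j\<in>UNIV - {i}. s * \<phi> j + t * \<psi> j)"
      by (simp add: prod_dividef)
  qed (use nz in auto)
  have "proj_point v \<in> C" if v: "v \<in> A \<union> B" for v
  proof -
    consider i where "v = f i" | "v \<in> A - range f" | "v \<in> B - A" using v by blast
    then show ?thesis
    proof cases
      case 1
      define k where "k = (\<Prod>j\<in>UNIV - {i}. \<psi> i * \<phi> j + - \<phi> i * \<psi> j)"
      have k: "k \<noteq> 0" unfolding k_def using indep[of _ i] by (auto simp: mult.commute)
      show ?thesis
      \<comment> \<open>At the zero of the factor \<open>i\<close> the curve passes through the
        coordinate point \<open>f i\<close>.\<close>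
      proof (rule in_C[of "\<psi> i" "- \<phi> i" "1 / k"])
        show "(\<psi> i, - \<phi> i) \<noteq> (0, 0)" using x_new_nonzero[OF b, of i] by (simp add: \<phi>_def)
        fix i'
        show "x i' v = 1 / k * (\<Prod>j\<in>UNIV - {i'}. \<psi> i * \<phi> j + - \<phi> i * \<psi> j)"
        proof (cases "i' = i")
          case False
          then have "(\<Prod>j\<in>UNIV - {i'}. \<psi> i * \<phi> j + - \<phi> i * \<psi> j) = 0"
            by (intro prod_zero) (auto intro!: bexI[of _ i])
          then show ?thesis using False 1 by (simp add: L_f)
        qed (use k 1 L_f in \<open>simp add: k_def\<close>)
      qed (use k in simp)
    next
      case 2
      then show ?thesis
        using reciprocal_rest_point[OF b b' \<open>b \<noteq> b'\<close> 2] reciprocal_in_C x_rest_nonzero by metis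
    next
      case 3
      then show ?thesis
        using reciprocal_new_point[OF b b' \<open>b \<noteq> b'\<close> 3] reciprocal_in_C x_new_nonzero by metis
    qed
  qed
  ultimately show ?thesis by blast
qed

end

lemma (in two_quartic_decompositions) common_rational_normal_curve_exists:
  "\<exists>C. rational_normal_curve C \<and> proj_point ` (A \<union> B) \<subseteq> C"
proof -
  obtain F where F: "F \<subseteq> A" "card F = Suc n" "finite F"
    using obtain_subset_with_card_n[of "Suc n" A] card_A n_pos by auto
  then obtain f where f: "bij_betw f (UNIV :: 'n set) F"
    using finite_same_card_bij[of "UNIV :: 'n set" F] CARD_eq by auto
  then have inj: "inj f" and range: "range f = F" by (auto simp: bij_betw_def)
  have "\<forall>i. \<exists>l. \<forall>j. cdot l (f j) = (if i = j then 1 else 0)"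
  proof
    fix i
    have "f i \<in> F" using range by auto
    then have c: "F - {f i} \<subseteq> A" "card (F - {f i}) = n" using F by auto
    obtain l where l: "\<forall>s\<in>F - {f i}. cdot l s = 0" "\<forall>a\<in>A - (F - {f i}). cdot l a \<noteq> 0"
      using functional_exists[OF c] by blast
    have "cdot l (f i) \<noteq> 0" using l(2) \<open>f i \<in> F\<close> F by auto
    moreover have "cdot l (f j) = 0" if "j \<noteq> i" for j
      using l(1) that range inj by (auto simp: inj_eq)
    ultimately show "\<exists>l. \<forall>j. cdot l (f j) = (if i = j then 1 else 0)"
      by (intro exI[of _ "(1 / cdot l (f i)) *s l"]) (auto simp: cdot_scale_left)
  qed
  from choice[OF this] obtain L where L: "\<And>i j. cdot (L i) (f j) = (if i = j then 1 else 0)" by blast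
  have c: "A - F \<subseteq> A" "card (A - F) = n" using F card_A by (auto simp: card_Diff_subset)
  obtain u where "u \<noteq> 0" "\<forall>p\<in>A - F. cdot u p = 0" using functional_exists[OF c] by blast
  then interpret framed_quartic_decompositions A n B \<alpha> \<beta> f L u
    by unfold_locales (use inj range F L in auto)
  show ?thesis by (rule common_rational_normal_curve)
qed

section \<open>Representatives of projective points\<close>

definition representative :: "(complex ^ 'n) set \<Rightarrow> complex ^ 'n" where
  "representative P = (SOME v. v \<noteq> 0 \<and> P = proj_point v)"

lemma representative:
  assumes "P \<in> proj_space"
  shows "representative P \<noteq> 0" "proj_point (representative P) = P" "representative P \<in> P"
proof -
  have "\<exists>v. v \<noteq> 0 \<and> P = proj_point v" using assms by (auto simp: proj_space_def)
  from someI_ex[OF this]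
  show "representative P \<noteq> 0" and *: "proj_point (representative P) = P"
    unfolding representative_def by auto
  have "representative P \<in> proj_point (representative P)" by (simp add: proj_point_def vec.span_base)
  then show "representative P \<in> P" unfolding * .
qed

lemma inj_on_representative: "A \<subseteq> proj_space \<Longrightarrow> inj_on representative A"
  by (rule inj_on_inverseI[of _ proj_point]) (auto simp: representative)

lemma proj_point_representative_image: "A \<subseteq> proj_space \<Longrightarrow> proj_point ` representative ` A = A"
  using representative(2) by (force simp: image_image)

lemma representative_power_in_veronese:
  "P \<in> proj_space \<Longrightarrow> linear_form (representative P) ^ d \<in> veronese d P"
  unfolding veronese_def by (intro mpoly.span_base imageI representative(3))

lemma computes_expansion:
  fixes A :: "(complex ^ ('n::finite)) set set"
  assumes "computes A T"
  obtains \<alpha> where "T = (\<Sum>v\<in>representative ` A. poly_scale (\<alpha> v) (linear_form v ^ 4))"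
proof -
  have A: "finite A" "A \<subseteq> proj_space" and T: "T \<in> mpoly.span (\<Union>P\<in>A. veronese 4 P)"
    using assms by (auto simp: computes_def)
  have "veronese 4 P \<subseteq> mpoly.span ((\<lambda>v. linear_form v ^ 4) ` representative ` A)" if "P \<in> A" for P
  proof -
    have "veronese 4 P = mpoly.span {linear_form (representative P) ^ 4}"
      using veronese_proj_point[of 4 "representative P"] representative(2)[of P] that A by auto
    then show ?thesis using that by (simp add: mpoly.span_mono)
  qed
  then have "mpoly.span (\<Union>P\<in>A. veronese 4 P) \<subseteq> mpoly.span ((\<lambda>v. linear_form v ^ 4) ` representative ` A)"
    by (intro mpoly.span_minimal) auto
  with T show thesis using span_finite_family[of "representative ` A" T] A that by blast
qed

text \<open>A term with zero coefficient could be omitted, and \<open>T\<close> would lie in the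
  span for a proper subset of \<open>A\<close>.\<close>

lemma minimal_coefficient_nonzero:
  fixes A :: "(complex ^ ('n::finite)) set set"
  assumes min: "minimal_for A T"
    and T: "T = (\<Sum>v\<in>representative ` A. poly_scale (\<alpha> v) (linear_form v ^ 4))"
    and v: "v \<in> representative ` A"
  shows "\<alpha> v \<noteq> 0"
proof
  assume "\<alpha> v = 0"
  have A: "finite A" "A \<subseteq> proj_space" using min by (auto simp: minimal_for_def computes_def)
  obtain P where P: "P \<in> A" "v = representative P" using v by blast
  have "T = (\<Sum>v\<in>representative ` A - {v}. poly_scale (\<alpha> v) (linear_form v ^ 4))"
    unfolding T using A v \<open>\<alpha> v = 0\<close> by (subst sum.remove[of _ v]) auto
  also have "\<dots> \<in> mpoly.span (\<Union>P\<in>A - {P}. veronese 4 P)"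
  proof (intro mpoly.span_sum mpoly.span_scale mpoly.span_base)
    fix w assume "w \<in> representative ` A - {v}"
    then obtain Q where "Q \<in> A - {P}" "w = representative Q" using P by auto
    then show "linear_form w ^ 4 \<in> (\<Union>P\<in>A - {P}. veronese 4 P)"
      using representative_power_in_veronese A by blast
  qed
  finally have "T \<in> mpoly.span (\<Union>P\<in>A - {P}. veronese 4 P)" .
  moreover have "A - {P} \<subset> A" using P by blast
  ultimately show False using min by (auto simp: minimal_for_def)
qed

theorem theorem6p3:
  fixes n :: nat
    and T :: "('n::finite) polynomial"
    and A B :: "(complex ^ 'n) set set"
  assumes "n \<ge> 1" and "CARD('n) = n + 1"
    and "T \<in> forms 4" and "T \<noteq> 0"
    and "computes A T" and "minimal_for A T"
    and "card A = 2 * n + 1" and "linear_general_position A"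
    and "computes B T" and "B \<noteq> A" and "card B \<le> 2 * n + 1"
  shows "card B = 2 * n + 1 \<and>
         (\<exists>C. rational_normal_curve C \<and> A \<subseteq> C \<and> B \<subseteq> C)"
proof -
  let ?r = "representative :: (complex ^ 'n) set \<Rightarrow> complex ^ 'n"
  have A: "finite A" "A \<subseteq> proj_space" and B: "finite B" "B \<subseteq> proj_space"
    using assms by (auto simp: computes_def)
  obtain \<alpha> where \<alpha>: "T = (\<Sum>v\<in>?r ` A. poly_scale (\<alpha> v) (linear_form v ^ 4))"
    using computes_expansion[OF \<open>computes A T\<close>] .
  obtain \<beta> where \<beta>: "T = (\<Sum>v\<in>?r ` B. poly_scale (\<beta> v) (linear_form v ^ 4))"
    using computes_expansion[OF \<open>computes B T\<close>] .
  have card_r: "card (?r ` S) = card S" if "S \<subseteq> proj_space" for S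
    by (rule card_image[OF inj_on_representative[OF that]])
  interpret two_quartic_decompositions "?r ` A" n "?r ` B" \<alpha> \<beta>
  proof unfold_locales
    show "card (?r ` A) = 2 * n + 1" "card (?r ` B) \<le> 2 * n + 1"
      using card_r A B assms by auto
    show "?r ` B \<noteq> ?r ` A" using proj_point_representative_image A B \<open>B \<noteq> A\<close> by metis
    show "\<alpha> a \<noteq> 0" if "a \<in> ?r ` A" for a
      by (rule minimal_coefficient_nonzero[OF \<open>minimal_for A T\<close> \<alpha> that])
    show "(\<Sum>a\<in>?r ` A. \<alpha> a * (cdot p a * cdot q a * cdot r a * cdot s a)) =
        (\<Sum>b\<in>?r ` B. \<beta> b * (cdot p b * cdot q b * cdot r b * cdot s b))" for p q r s
      by (rule quartic_moments_eq) (use \<alpha> \<beta> in simp)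
  next
    fix S assume "S \<subseteq> ?r ` A" "card S \<le> Suc n"
    then obtain S' where S': "S' \<subseteq> A" "S = ?r ` S'" by (metis subset_imageE)
    then have "card S' \<le> min (card A) CARD('n)"
      using card_r[of S'] A \<open>card S \<le> Suc n\<close> assms(2) card_mono[of A S'] by auto
    then have "lin_indep_points S'"
      using \<open>linear_general_position A\<close> S' by (auto simp: linear_general_position_def)
    \<comment> \<open>\<open>lin_indep_points\<close> covers every choice of nonzero
      representatives, in particular \<open>representative\<close>.\<close>
    then show "vec.independent S"
      unfolding lin_indep_points_def S' using representative S' A by blast
  next
    fix v w and c :: complex
    assume "v \<in> ?r ` A \<union> ?r ` B" "w \<in> ?r ` A \<union> ?r ` B" "v \<noteq> w"
    then obtain P Q where P: "v = ?r P" "P \<in> proj_space" and Q: "w = ?r Q" "Q \<in> proj_space"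
      using A B by blast
    show "v \<noteq> c *s w"
    proof
      assume v: "v = c *s w"
      then have "c \<noteq> 0" using representative(1)[OF P(2)] P(1) by auto
      then have "proj_point v = proj_point w" using v proj_point_scale by metis
      then show False using representative(2) P Q \<open>v \<noteq> w\<close> by metis
    qed
  qed (use assms B in auto)
  obtain C where "rational_normal_curve C" "proj_point ` (?r ` A \<union> ?r ` B) \<subseteq> C"
    using common_rational_normal_curve_exists by blast
  then have "A \<subseteq> C" "B \<subseteq> C"
    using proj_point_representative_image A B by (metis image_Un le_sup_iff)+
  moreover have "card B = 2 * n + 1" using card_B card_r B by simp
  ultimately show ?thesis using \<open>rational_normal_curve C\<close> by blast
qed

end
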